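(* Let $(R,\mathfrak{m})$ be a noetherian local ring with $i(R)=0$. If $R$ is not a field, then $R$ is a one-dimensional regular local ring.
   Context: All rings are commutative with identity. For an ideal $J$ of a noetherian ring $R$, an element $x\in R$ is integral over $J$ if $x^n+a_1x^{n-1}+\cdots+a_n=0$ for some $n\geq 1$ and $a_i\in J^i$ ($1\le i\le n$); the integral closure $\overline{J}$ is the ideal of all elements integral over $J$. The integral dimension $i(R)$ of a noetherian ring $R$ is the least integer $k\geq 0$ such that $(\overline{J})^n\subseteq J^{n-k}$ for all ideals $J$ of $R$ and all $n\geq k$ (with $J^0=R$), if such a $k$ exists; otherwise $i(R)=\infty$. *)

theory Defs
  imports
    "HOL-Algebra.Ideal_Product"
    "HOL-Algebra.Ring_Divisibility"
    "HOL-Library.Extended_Nat"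
begin

text \<open>Powers of an ideal are taken in the multiplicative monoid of ideals; in particular the
  zeroth power is the whole ring.\<close>

abbreviation ideal_pow :: "('a, 'b) ring_scheme \<Rightarrow> 'a set \<Rightarrow> nat \<Rightarrow> 'a set"
  where "ideal_pow R J n \<equiv> J [^]\<^bsub>ideals_set R\<^esub> n"

definition integral_over :: "('a, 'b) ring_scheme \<Rightarrow> 'a set \<Rightarrow> 'a \<Rightarrow> bool"
  where "integral_over R J x \<longleftrightarrow>
    (\<exists>n a. n \<ge> (1::nat) \<and> (\<forall>i\<in>{1..n}. a i \<in> ideal_pow R J i) \<and>
       x [^]\<^bsub>R\<^esub> n \<oplus>\<^bsub>R\<^esub> (\<Oplus>\<^bsub>R\<^esub>i\<in>{1..n}. a i \<otimes>\<^bsub>R\<^esub> x [^]\<^bsub>R\<^esub> (n - i)) = \<zero>\<^bsub>R\<^esub>)"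

definition integral_closure :: "('a, 'b) ring_scheme \<Rightarrow> 'a set \<Rightarrow> 'a set"
  where "integral_closure R J = {x \<in> carrier R. integral_over R J x}"

text \<open>The infimum of the empty set is \<open>\<infinity>\<close>, and a nonempty set of extended naturals
  contains its infimum.\<close>

definition integral_dimension :: "('a, 'b) ring_scheme \<Rightarrow> enat"
  where "integral_dimension R =
    Inf {enat k | k. \<forall>J. ideal J R \<longrightarrow>
           (\<forall>n\<ge>k. ideal_pow R (integral_closure R J) n \<subseteq> ideal_pow R J (n - k))}"

text \<open>The supremum of the lengths \<open>n\<close> of chains
  \<open>P 0 \<subset> P 1 \<subset> \<dots> \<subset> P n\<close> of prime ideals
  (with value \<open>0\<close> for the zero ring, which has no prime ideals).\<close>

definition krull_dimension :: "('a, 'b) ring_scheme \<Rightarrow> enat"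
  where "krull_dimension R =
    Sup {enat n | n. \<exists>P. (\<forall>i\<le>n. primeideal (P i) R) \<and> (\<forall>i<n. P i \<subset> P (Suc i))}"

definition min_generators :: "('a, 'b) ring_scheme \<Rightarrow> 'a set \<Rightarrow> enat"
  where "min_generators R I =
    Inf {enat (card A) | A. finite A \<and> A \<subseteq> carrier R \<and> I = Idl\<^bsub>R\<^esub> A}"

locale noetherian_local_ring = cring R + noetherian_ring R + maximalideal M R
    for M and R (structure) +
  assumes unique_maximal: "maximalideal N R \<Longrightarrow> N = M"

locale regular_local_ring = noetherian_local_ring +
  assumes regular: "min_generators R M = krull_dimension R"

end

theory Submission
  imports Defs
begin

text \<open>
  Taking \<open>n = 1\<close> in the inclusions that define the integral dimension shows that
  \<open>i(R) = 0\<close> makes every ideal of \<open>R\<close> integrally closed. The proof only ever exploits this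
  through integral equations of degree two, applied to four kinds of ideals.

  \<^item> For \<open>J = 0\<close> the equation \<open>u\<^sup>2 = 0\<close> gives \<open>u = 0\<close>.
  \<^item> If \<open>u v = 0\<close>, then \<open>u\<^sup>2 - (u + v) u = 0\<close>, so \<open>u = r (u + v)\<close> for some \<open>r\<close>. In a local
    ring \<open>r\<close> or \<open>1 - r\<close> is a unit. Multiplying \<open>u = r (u + v)\<close> by \<open>v\<close> or by \<open>u\<close> yields
    \<open>r v\<^sup>2 = 0\<close> and \<open>(1 - r) u\<^sup>2 = 0\<close>, so \<open>v = 0\<close> or \<open>u = 0\<close>: the ring is a domain.
  \<^item> For arbitrary \<open>x\<close> and \<open>y\<close>, the product \<open>x y\<close> is integral over \<open>(x\<^sup>2, y\<^sup>2)\<close>, since its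
    square is the product of the two generators. Hence \<open>x y = a x\<^sup>2 + b y\<^sup>2\<close>.
  \<^item> Multiplying this relation by \<open>a\<close> exhibits \<open>a x\<close> as a root of \<open>t\<^sup>2 - y t + a b y\<^sup>2\<close>, which
    makes it integral over \<open>(y)\<close>, say \<open>a x = c y\<close>. If \<open>c\<close> is a unit, then \<open>x\<close> divides \<open>y\<close>.
    Otherwise \<open>1 - c\<close> is a unit, and for \<open>y \<noteq> 0\<close> cancelling \<open>y\<close> in \<open>(1 - c) x y = b y\<^sup>2\<close>
    shows that \<open>y\<close> divides \<open>x\<close>; everything divides \<open>y = 0\<close>.

  So divisibility is total, and a noetherian domain with total divisibility is a principal ideal
  domain: a maximal principal ideal inside a given ideal is all of it. In a local principal ideal
  domain that is not a field the primes are exactly \<open>0\<close> and the maximal ideal, and the latter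
  needs exactly one generator.
\<close>

section \<open>Maximal ideals and units in noetherian local rings\<close>

lemma (in noetherian_ring) nonempty_ideal_family_has_maximal:
  assumes "S \<noteq> {}" and "\<And>I. I \<in> S \<Longrightarrow> ideal I R"
  shows "\<exists>N\<in>S. \<forall>I\<in>S. N \<subseteq> I \<longrightarrow> I = N"
proof (rule subset_Zorn_nonempty [OF assms(1)])
  fix C assume C: "C \<noteq> {}" "subset.chain S C"
  have "subset.chain {I. ideal I R} C"
    using C(2) assms(2) unfolding subset.chain_def by blast
  then have "\<Union>C \<in> C" by (rule ideal_chain_is_trivial [OF C(1)])
  then show "\<Union>C \<in> S" using C(2) unfolding subset.chain_def by blast
qed

text \<open>This is what turns uniqueness of the maximal ideal into a supply of units.\<close>

lemma (in noetherian_ring) proper_ideal_subset_maximalideal: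
  assumes "ideal I R" and "I \<noteq> carrier R"
  shows "\<exists>N. maximalideal N R \<and> I \<subseteq> N"
proof -
  define S where "S = {J. ideal J R \<and> I \<subseteq> J \<and> J \<noteq> carrier R}"
  have "\<exists>N\<in>S. \<forall>J\<in>S. N \<subseteq> J \<longrightarrow> J = N"
    by (rule nonempty_ideal_family_has_maximal) (use assms S_def in auto)
  then obtain N where "N \<in> S" and max: "\<And>J. J \<in> S \<Longrightarrow> N \<subseteq> J \<Longrightarrow> J = N"
    by metis
  then have N: "ideal N R" "I \<subseteq> N" "N \<noteq> carrier R" by (auto simp: S_def)
  have "maximalideal N R"
  proof (rule maximalidealI [OF N(1)])
    show "carrier R \<noteq> N" using N(3) by blast
  next
    fix J assume "ideal J R" "N \<subseteq> J" "J \<subseteq> carrier R"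
    then show "J = N \<or> J = carrier R" using max [of J] N(2) by (auto simp: S_def)
  qed
  then show ?thesis using N(2) by blast
qed

context noetherian_local_ring
begin

lemma unit_if_not_in_maximal:
  assumes "c \<in> carrier R" and "c \<notin> M"
  shows "c \<in> Units R"
proof (rule ccontr)
  assume "c \<notin> Units R"
  then have "PIdl c \<noteq> carrier R" using ideal_eq_carrier_iff [OF assms(1)] by simp
  then obtain N where "maximalideal N R" "PIdl c \<subseteq> N"
    using proper_ideal_subset_maximalideal cgenideal_ideal [OF assms(1)] by blast
  then show False using unique_maximal cgenideal_self [OF assms(1)] assms(2) by blast
qed

text \<open>Two nonunits of a local ring cannot sum to \<open>1\<close>. This dichotomy is the only way in which
  locality enters the integrality arguments.\<close>

lemma unit_or_one_minus_unit:
  assumes c: "c \<in> carrier R"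
  shows "c \<in> Units R \<or> \<one> \<ominus> c \<in> Units R"
proof (rule ccontr)
  assume "\<not> ?thesis"
  then have "c \<in> M" "\<one> \<ominus> c \<in> M" using unit_if_not_in_maximal [of c] unit_if_not_in_maximal [of "\<one> \<ominus> c"] c by auto
  then have "c \<oplus> (\<one> \<ominus> c) \<in> M" by (rule a_closed)
  moreover have "c \<oplus> (\<one> \<ominus> c) = \<one>" using c by algebra
  ultimately have "M = carrier R" using one_imp_carrier by simp
  then show False using I_notcarr by simp
qed

end

section \<open>Quadratic integral equations and integral dimension zero\<close>

context cring
begin

lemma unit_mult_eq_zero:
  assumes "r \<in> Units R" "x \<in> carrier R" "r \<otimes> x = \<zero>"
  shows "x = \<zero>"
  using assms Units_l_cancel [OF assms(1,2) zero_closed] by (simp add: Units_closed)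

lemma ideal_pow_one:
  assumes "ideal J R"
  shows "ideal_pow R J 1 = J"
proof -
  interpret I: comm_monoid "ideals_set R" by (rule ideals_set_is_comm_monoid)
  show ?thesis using assms I.nat_pow_eone [of J] by (simp add: ideals_set_def)
qed

lemma ideal_pow_two:
  assumes "ideal J R"
  shows "ideal_pow R J 2 = J \<cdot> J"
  using ideal_pow_one [OF assms] unfolding One_nat_def numeral_2_eq_2
  by (simp add: nat_pow_def ideals_set_def)

lemma quadratic_root_in_integral_closure:
  assumes J: "ideal J R" and x: "x \<in> carrier R" and p: "p \<in> J" and q: "q \<in> J \<cdot> J"
    and eq: "x \<otimes> x \<oplus> (p \<otimes> x \<oplus> q) = \<zero>"
  shows "x \<in> integral_closure R J"
proof -
  define a where "a = (\<lambda>i::nat. if i = 1 then p else q)"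
  have pc: "p \<in> carrier R" using p J by (rule ideal.Icarr [rotated])
  have qc: "q \<in> carrier R" using q ideal_prod_in_carrier [OF J J] by blast
  have interval: "{1..2::nat} = {1, 2}" by auto
  have "(\<Oplus>i\<in>{1, 2}. a i \<otimes> x [^] (2 - i)) = p \<otimes> x \<oplus> q"
  proof -
    have terms: "a 1 \<otimes> x [^] (2 - 1 :: nat) = p \<otimes> x" "a 2 \<otimes> x [^] (2 - 2 :: nat) = q"
      using x pc qc by (simp_all add: a_def)
    have "(\<Oplus>i\<in>{1, 2}. a i \<otimes> x [^] (2 - i))
        = a 1 \<otimes> x [^] (2 - 1 :: nat) \<oplus> (\<Oplus>i\<in>{2}. a i \<otimes> x [^] (2 - i))"
      by (rule finsum_insert) (use x pc qc in \<open>simp_all add: a_def\<close>)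
    also have "(\<Oplus>i\<in>{2}. a i \<otimes> x [^] (2 - i)) = a 2 \<otimes> x [^] (2 - 2 :: nat) \<oplus> (\<Oplus>i\<in>{}. a i \<otimes> x [^] (2 - i))"
      by (rule finsum_insert) (use x pc qc in \<open>simp_all add: a_def\<close>)
    finally show ?thesis using pc qc x unfolding terms by simp
  qed
  moreover have "x [^] (2::nat) = x \<otimes> x" using x by (simp add: numeral_2_eq_2)
  moreover have "\<forall>i\<in>{1, 2}. a i \<in> ideal_pow R J i"
    using p q by (simp only: ball_simps a_def ideal_pow_one [OF J] ideal_pow_two [OF J]) simp
  ultimately have "integral_over R J x"
    unfolding integral_over_def using eq
    by (intro exI [of _ 2] exI [of _ a]) (simp only: interval, simp)
  then show ?thesis using x by (simp add: integral_closure_def)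
qed

text \<open>The infimum in the integral dimension is attained, so the value \<open>0\<close> means that the defining
  inclusions hold with \<open>k = 0\<close>; the inclusion for \<open>n = 1\<close> is the claim.\<close>

lemma integrally_closed_if_integral_dimension_zero:
  assumes dim: "integral_dimension R = 0" and J: "ideal J R"
  shows "integral_closure R J \<subseteq> J"
proof
  fix x assume x: "x \<in> integral_closure R J"
  then have xc: "x \<in> carrier R" by (simp add: integral_closure_def)
  define S where "S = {enat k | k. \<forall>J. ideal J R \<longrightarrow>
      (\<forall>n\<ge>k. ideal_pow R (integral_closure R J) n \<subseteq> ideal_pow R J (n - k))}"
  have Inf: "Inf S = 0" using dim by (simp add: integral_dimension_def S_def)
  then have "S \<noteq> {}" by (auto simp: top_enat_def)
  then have "Inf S \<in> S" using wellorder_InfI [of _ S] by fast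
  then have "0 \<in> S" by (simp only: Inf)
  then have "\<forall>n. ideal_pow R (integral_closure R J) n \<subseteq> ideal_pow R J n"
    using J by (simp add: S_def zero_enat_def)
  then have "ideal_pow R (integral_closure R J) 1 \<subseteq> ideal_pow R J 1" by (rule spec)
  then have "ideal_pow R (integral_closure R J) 1 \<subseteq> J"
    by (simp only: ideal_pow_one [OF J])
  \<comment> \<open>The integral closure is not known to be an ideal here, so its first power cannot be
    identified with it. That power is the product with the whole ring, hence contains \<open>\<one> \<otimes> x\<close>.\<close>
  moreover have "\<one> \<otimes> x \<in> ideal_pow R (integral_closure R J) 1"
    using ideal_prod.prod [OF one_closed x] by (simp add: nat_pow_def ideals_set_def)
  ultimately show "x \<in> J" using xc by auto
qed

lemma mem_if_quadratic_root:
  assumes "integral_dimension R = 0"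
    and "ideal J R" "x \<in> carrier R" "p \<in> J" "q \<in> J \<cdot> J"
    and "x \<otimes> x \<oplus> (p \<otimes> x \<oplus> q) = \<zero>"
  shows "x \<in> J"
  using integrally_closed_if_integral_dimension_zero quadratic_root_in_integral_closure assms
  by blast

lemma square_zero_imp_zero:
  assumes dim: "integral_dimension R = 0" and u: "u \<in> carrier R" and "u \<otimes> u = \<zero>"
  shows "u = \<zero>"
proof -
  have "\<zero> \<otimes> \<zero> \<in> {\<zero>} \<cdot> {\<zero>}" by (intro ideal_prod.prod) simp_all
  then have "u \<in> {\<zero>}"
    using assms by (intro mem_if_quadratic_root [OF dim zeroideal u, of \<zero> \<zero>]) simp_all
  then show ?thesis by simp
qed

end

section \<open>Divisibility in local rings of integral dimension zero\<close>

context noetherian_local_ring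
begin

text \<open>For \<open>u v = 0\<close> the element \<open>u\<close> is a root of \<open>t\<^sup>2 - (u + v) t\<close>, so it lies in the ideal
  generated by \<open>u + v\<close>; the unit dichotomy for its coefficient kills \<open>u\<^sup>2\<close> or \<open>v\<^sup>2\<close>.\<close>

lemma domain_if_integral_dimension_zero:
  assumes dim: "integral_dimension R = 0"
  shows "domain R"
proof (rule domain.intro [OF is_cring], unfold_locales)
  show "\<one> \<noteq> \<zero>" 
    using I_notcarr carrier_one_zero additive_subgroup.zero_closed
      is_additive_subgroup Icarr by fastforce
next
  fix u v
  assume uv: "u \<otimes> v = \<zero>" and u: "u \<in> carrier R" and v: "v \<in> carrier R"
  have s: "u \<oplus> v \<in> carrier R" using u v by simp
  let ?J = "PIdl (u \<oplus> v)"
  have J: "ideal ?J R" using s by (rule cgenideal_ideal)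
  interpret J: ideal ?J R by fact
  have "u \<in> ?J"
  proof (rule mem_if_quadratic_root [OF dim J u])
    show "\<ominus> (u \<oplus> v) \<in> ?J" using cgenideal_self [OF s] by simp
    show "\<zero> \<in> ?J \<cdot> ?J"
      using ideal_prod_is_ideal [OF J J] by (simp add: additive_subgroup.zero_closed ideal.axioms(1))
    have "u \<otimes> u \<oplus> (\<ominus> (u \<oplus> v) \<otimes> u \<oplus> \<zero>) = \<ominus> (u \<otimes> v)" using u v by algebra
    then show "u \<otimes> u \<oplus> (\<ominus> (u \<oplus> v) \<otimes> u \<oplus> \<zero>) = \<zero>" using uv by simp
  qed
  then obtain r where r: "r \<in> carrier R" and eq: "u = r \<otimes> (u \<oplus> v)"
    unfolding cgenideal_def by blast
  from unit_or_one_minus_unit [OF r] show "u = \<zero> \<or> v = \<zero>"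
  proof
    assume unit: "r \<in> Units R"
    have "r \<otimes> (v \<otimes> v) = r \<otimes> (u \<oplus> v) \<otimes> v \<ominus> r \<otimes> (u \<otimes> v)" using r u v by algebra
    also have "\<dots> = \<zero>" using uv r by (simp add: eq [symmetric] minus_eq)
    finally have "v \<otimes> v = \<zero>" using unit_mult_eq_zero [OF unit, of "v \<otimes> v"] v by blast
    then show ?thesis using square_zero_imp_zero [OF dim] v by blast
  next
    assume unit: "\<one> \<ominus> r \<in> Units R"
    have "(\<one> \<ominus> r) \<otimes> (u \<otimes> u) = r \<otimes> (u \<otimes> v) \<oplus> (u \<ominus> r \<otimes> (u \<oplus> v)) \<otimes> u" using r u v by algebra
    also have "\<dots> = \<zero>" using uv r u v by (simp add: eq [symmetric] r_neg minus_eq)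
    finally have "u \<otimes> u = \<zero>" using unit_mult_eq_zero [OF unit, of "u \<otimes> u"] u by blast
    then show ?thesis using square_zero_imp_zero [OF dim] u by blast
  qed
qed

text \<open>For nonzero \<open>x\<close> and \<open>y\<close>, read in the fraction field, the relation \<open>x y = a x\<^sup>2 + b y\<^sup>2\<close> is a quadratic equation
  for \<open>s = x / y\<close> whose middle coefficient is a unit. Clearing the leading coefficient shows that
  \<open>a s\<close> is integral over the ring; since \<open>(y)\<close> is integrally closed, \<open>c = a s\<close> is a ring element.
  Now \<open>c = a s\<close> and \<open>(1 - c) s = b\<close>, so inverting \<open>c\<close> or \<open>1 - c\<close> puts \<open>1 / s\<close> or \<open>s\<close> into
  the ring.\<close>

lemma divides_linear_if_integral_dimension_zero:
  assumes dim: "integral_dimension R = 0" and x: "x \<in> carrier R" and y: "y \<in> carrier R"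
  shows "x divides y \<or> y divides x"
proof -
  interpret D: domain R using dim by (rule domain_if_integral_dimension_zero)
  have xx: "x \<otimes> x \<in> carrier R" and yy: "y \<otimes> y \<in> carrier R" using x y by simp_all
  define J where "J = set_add R (PIdl (x \<otimes> x)) (PIdl (y \<otimes> y))"
  have Jx: "ideal (PIdl (x \<otimes> x)) R" and Jy: "ideal (PIdl (y \<otimes> y)) R"
    using xx yy by (simp_all add: cgenideal_ideal)
  have J: "ideal J R" unfolding J_def using Jx Jy by (rule add_ideals)
  interpret J: ideal J R by fact
  interpret JJ: ideal "J \<cdot> J" R using J J by (rule ideal_prod_is_ideal)
  have sum_in_J: "p \<oplus> q \<in> J" if "p \<in> PIdl (x \<otimes> x)" "q \<in> PIdl (y \<otimes> y)" for p q
    unfolding J_def set_add_def' using that by blast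
  have zx: "\<zero> \<in> PIdl (x \<otimes> x)" and zy: "\<zero> \<in> PIdl (y \<otimes> y)"
    using Jx Jy by (simp_all add: additive_subgroup.zero_closed ideal.axioms(1))
  have xJ: "x \<otimes> x \<in> J" using sum_in_J [OF cgenideal_self [OF xx] zy] xx by simp
  have yJ: "y \<otimes> y \<in> J" using sum_in_J [OF zx cgenideal_self [OF yy]] yy by simp
  have "x \<otimes> y \<in> J"
  proof (rule mem_if_quadratic_root [OF dim J])
    show "x \<otimes> y \<in> carrier R" using x y by simp
    show "\<zero> \<in> J" by simp
    show "\<ominus> ((x \<otimes> x) \<otimes> (y \<otimes> y)) \<in> J \<cdot> J"
      using ideal_prod.prod [OF xJ yJ, of R] by simp
    show "x \<otimes> y \<otimes> (x \<otimes> y) \<oplus> (\<zero> \<otimes> (x \<otimes> y) \<oplus> \<ominus> (x \<otimes> x \<otimes> (y \<otimes> y))) = \<zero>"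
      using x y by algebra
  qed
  then obtain a b where a: "a \<in> carrier R" and b: "b \<in> carrier R"
      and rel: "x \<otimes> y = a \<otimes> (x \<otimes> x) \<oplus> b \<otimes> (y \<otimes> y)"
    unfolding J_def set_add_def' cgenideal_def by blast
  define K where "K = PIdl y"
  have K: "ideal K R" unfolding K_def using y by (rule cgenideal_ideal)
  interpret K: ideal K R by fact
  interpret KK: ideal "K \<cdot> K" R using ideal_prod_is_ideal [OF K K] .
  have yK: "y \<in> K" unfolding K_def using y by (rule cgenideal_self)
  have "a \<otimes> x \<in> K"
  proof (rule mem_if_quadratic_root [OF dim K])
    show "a \<otimes> x \<in> carrier R" using a x by simp
    show "\<ominus> y \<in> K" using yK by simp
    show "(a \<otimes> b) \<otimes> (y \<otimes> y) \<in> K \<cdot> K"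
      using ideal_prod.prod [OF yK yK, of R] a b by (simp add: KK.I_l_closed)
    have "a \<otimes> x \<otimes> (a \<otimes> x) \<oplus> (\<ominus> y \<otimes> (a \<otimes> x) \<oplus> a \<otimes> b \<otimes> (y \<otimes> y))
        = a \<otimes> (\<ominus> (x \<otimes> y) \<oplus> (a \<otimes> (x \<otimes> x) \<oplus> b \<otimes> (y \<otimes> y)))"
      using a b x y by algebra
    also have "\<dots> = \<zero>" using a x y by (simp add: rel [symmetric] l_neg)
    finally show "a \<otimes> x \<otimes> (a \<otimes> x) \<oplus> (\<ominus> y \<otimes> (a \<otimes> x) \<oplus> a \<otimes> b \<otimes> (y \<otimes> y)) = \<zero>" .
  qed
  then obtain c where c: "c \<in> carrier R" and ax: "a \<otimes> x = c \<otimes> y"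
    unfolding K_def cgenideal_def by blast
  from unit_or_one_minus_unit [OF c] show ?thesis
  proof
    assume unit: "c \<in> Units R"
    have "y = inv c \<otimes> (c \<otimes> y)" using unit c y by (simp flip: m_assoc)
    also have "\<dots> = x \<otimes> (inv c \<otimes> a)"
      unfolding ax [symmetric] using unit a x by (simp add: m_ac)
    finally have "x divides y" using unit a by (intro dividesI) simp_all
    then show ?thesis ..
  next
    assume unit: "\<one> \<ominus> c \<in> Units R"
    have "y \<otimes> (x \<otimes> (\<one> \<ominus> c) \<ominus> b \<otimes> y) = y \<otimes> x \<ominus> (c \<otimes> y \<otimes> x \<oplus> b \<otimes> (y \<otimes> y))"
      using b c x y by algebra
    also have "\<dots> = x \<otimes> y \<ominus> (a \<otimes> (x \<otimes> x) \<oplus> b \<otimes> (y \<otimes> y))"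
      unfolding ax [symmetric] using a x y by (simp add: m_assoc m_comm [of y x])
    also have "\<dots> = \<zero>" unfolding rel [symmetric] using x y by (simp add: r_neg minus_eq)
    finally have "y = \<zero> \<or> x \<otimes> (\<one> \<ominus> c) \<ominus> b \<otimes> y = \<zero>"
      by (rule D.integral) (use b c x y in simp_all)
    then show ?thesis
    proof
      assume "y = \<zero>"
      then have "x divides y" using x by (intro dividesI [of \<zero>]) simp_all
      then show ?thesis ..
    next
      assume "x \<otimes> (\<one> \<ominus> c) \<ominus> b \<otimes> y = \<zero>"
      then have eq: "(\<one> \<ominus> c) \<otimes> x = b \<otimes> y" using b c x y by (simp add: m_comm)
      let ?i = "inv (\<one> \<ominus> c)"
      have "x = ?i \<otimes> ((\<one> \<ominus> c) \<otimes> x)" using unit c x by (simp flip: m_assoc)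
      also have "\<dots> = y \<otimes> (?i \<otimes> b)" unfolding eq using unit b y by (simp add: m_ac)
      finally have "y divides x" using unit b by (intro dividesI) simp_all
      then show ?thesis ..
    qed
  qed
qed

end

section \<open>Local principal ideal domains\<close>

text \<open>Choose \<open>t\<close> in the ideal \<open>I\<close> with the principal ideal of \<open>t\<close> as large as possible. An
  element of \<open>I\<close> that divides \<open>t\<close> then generates the same ideal, so \<open>t\<close> divides every element of
  \<open>I\<close>. The family of candidates is nonempty because it contains the zero ideal.\<close>

lemma (in noetherian_domain) principal_domain_if_divides_linear:
  assumes linear: "\<And>x y. x \<in> carrier R \<Longrightarrow> y \<in> carrier R \<Longrightarrow> x divides y \<or> y divides x"
  shows "principal_domain R"
proof unfold_locales
  fix I assume I: "ideal I R"
  interpret I: ideal I R by fact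
  define S where "S = {PIdl x | x. x \<in> I}"
  have "PIdl \<zero> \<in> S" unfolding S_def using I.zero_closed by blast
  then have "\<exists>N\<in>S. \<forall>K\<in>S. N \<subseteq> K \<longrightarrow> K = N"
    by (intro nonempty_ideal_family_has_maximal) (auto simp: S_def cgenideal_ideal)
  then obtain N where "N \<in> S" and maxN: "\<And>K. K \<in> S \<Longrightarrow> N \<subseteq> K \<Longrightarrow> K = N"
    by metis
  then obtain t where t: "t \<in> I" and N: "N = PIdl t" by (auto simp: S_def)
  have max: "PIdl y = PIdl t" if "y \<in> I" "PIdl t \<subseteq> PIdl y" for y
    using maxN [of "PIdl y"] that by (auto simp: S_def N)
  have "y \<in> PIdl t" if y: "y \<in> I" for y
  proof -
    have "PIdl y \<subseteq> PIdl t"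
      using linear [of t y] max [OF y] to_contain_is_to_divide [of t y]
        to_contain_is_to_divide [of y t] t y by auto
    then show ?thesis using cgenideal_self [of y] y by auto
  qed
  then have "I \<subseteq> PIdl t" by (rule subsetI)
  then have "I = PIdl t" using cgenideal_minimal [OF I t] by (rule subset_antisym)
  moreover have "t \<in> carrier R" using t by (rule I.Icarr)
  ultimately show "\<exists>a\<in>carrier R. I = PIdl a" by (rule bexI)
qed

text \<open>A nonzero prime ideal is generated by a prime element, and these are irreducible.\<close>

lemma (in principal_domain) nonzero_primeideal_is_maximal:
  assumes P: "primeideal P R" and "P \<noteq> {\<zero>}"
  shows "maximalideal P R"
proof -
  obtain p where p: "p \<in> carrier R" "P = PIdl p"
    using exists_gen P primeideal.axioms(1) by blast
  have "p \<noteq> \<zero>" using assms(2) p by (auto simp: cgenideal_eq_genideal genideal_zero)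
  then have "ring_irreducible p" using P p primeideal_iff_prime primeness_condition by auto
  then show ?thesis using irreducible_imp_maximalideal p by simp
qed

text \<open>Every member of a chain of primes except the first is nonzero, hence equal to \<open>M\<close>; so a strict
  chain has at most one step, and \<open>0 \<subset> M\<close> is such a chain.\<close>

lemma (in noetherian_local_ring) krull_dimension_local_principal_domain:
  assumes pid: "principal_domain R" and M: "M \<noteq> {\<zero>}"
  shows "krull_dimension R = 1"
proof -
  interpret D: principal_domain R by fact
  define S where "S = {enat n | n. \<exists>P. (\<forall>i\<le>n. primeideal (P i) R) \<and> (\<forall>i<n. P i \<subset> P (Suc i))}"
  have "e \<le> 1" if "e \<in> S" for e
  proof -
    from that obtain n P where e: "e = enat n" and prime: "\<And>i. i \<le> n \<Longrightarrow> primeideal (P i) R"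
        and chain: "\<And>i. i < n \<Longrightarrow> P i \<subset> P (Suc i)" unfolding S_def by blast
    have eqM: "P (Suc i) = M" if "Suc i \<le> n" for i
    proof -
      have "\<zero> \<in> P i"
        using prime [of i] that
        by (simp add: primeideal_def ideal.axioms(1) additive_subgroup.zero_closed)
      then have "P (Suc i) \<noteq> {\<zero>}" using chain [of i] that by auto
      then show ?thesis using D.nonzero_primeideal_is_maximal prime that unique_maximal by blast
    qed
    have "\<not> 2 \<le> n"
    proof
      assume "2 \<le> n"
      then have "P 1 = M" "P 2 = M" "P 1 \<subset> P 2"
        using eqM [of 0] eqM [of 1] chain [of 1] by (simp_all add: numeral_2_eq_2)
      then show False by simp
    qed
    then show ?thesis using e by (simp add: one_enat_def)
  qed
  moreover have "1 \<in> S"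
  proof -
    define P where "P = (\<lambda>i::nat. if i = 0 then {\<zero>} else M)"
    have "{\<zero>} \<subset> M" using M zero_closed by blast
    moreover have "primeideal M R" using maximalideal_prime is_maximalideal by blast
    ultimately have "(\<forall>i\<le>1. primeideal (P i) R) \<and> (\<forall>i<1. P i \<subset> P (Suc i))"
      using D.zeroprimeideal by (simp add: P_def)
    then show ?thesis unfolding S_def one_enat_def
      by (intro CollectI exI [of _ 1] conjI [OF refl] exI [of _ P])
  qed
  ultimately show ?thesis
    unfolding krull_dimension_def S_def [symmetric] by (intro antisym Sup_least Sup_upper)
qed

lemma (in cring) min_generators_PIdl:
  assumes "t \<in> carrier R" and "PIdl t \<noteq> {\<zero>}"
  shows "min_generators R (PIdl t) = 1"
proof -
  define S where "S = {enat (card A) | A. finite A \<and> A \<subseteq> carrier R \<and> PIdl t = Idl A}"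
  have "1 \<le> e" if e: "e \<in> S" for e
  proof -
    obtain A where A: "e = enat (card A)" "finite A" "PIdl t = Idl A" using e unfolding S_def by blast
    have "A \<noteq> {}"
    proof
      assume "A = {}"
      then have "PIdl t \<subseteq> {\<zero>}" using A(3) genideal_minimal [OF zeroideal] by simp
      moreover have "\<zero> \<in> PIdl t"
        using cgenideal_ideal [OF assms(1)] by (simp add: additive_subgroup.zero_closed ideal.axioms(1))
      ultimately show False using assms(2) by blast
    qed
    then have "1 \<le> card A" using A(2) by (simp add: Suc_le_eq card_gt_0_iff)
    then show ?thesis using A(1) by (simp add: one_enat_def)
  qed
  moreover have "1 \<in> S"
  proof -
    have "PIdl t = Idl {t}" using assms(1) by (rule cgenideal_eq_genideal)
    moreover have "1 = enat (card {t})" by (simp add: one_enat_def)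
    ultimately show ?thesis unfolding S_def using assms(1) by blast
  qed
  ultimately show ?thesis
    unfolding min_generators_def S_def [symmetric] by (intro antisym Inf_lower Inf_greatest)
qed

theorem proposition2p13:
  fixes R :: "('a, 'b) ring_scheme" and \<mm> :: "'a set"
  assumes "noetherian_local_ring \<mm> R"
    and "integral_dimension R = 0"
    and "\<not> field R"
  shows "regular_local_ring \<mm> R \<and> krull_dimension R = 1"
proof -
  interpret noetherian_local_ring \<mm> R by fact
  interpret D: domain R using assms(2) by (rule domain_if_integral_dimension_zero)
  interpret N: noetherian_domain R ..
  interpret P: principal_domain R
    using divides_linear_if_integral_dimension_zero [OF assms(2)]
    by (rule N.principal_domain_if_divides_linear)
  have nonzero: "\<mm> \<noteq> {\<zero>\<^bsub>R\<^esub>}"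
    using zeromaximalideal_fieldI is_maximalideal assms(3) by blast
  have krull: "krull_dimension R = 1"
    using P.principal_domain_axioms nonzero by (rule krull_dimension_local_principal_domain)
  obtain t where "t \<in> carrier R" "\<mm> = PIdl\<^bsub>R\<^esub> t" using P.exists_gen is_ideal by blast
  then have "min_generators R \<mm> = 1" using nonzero min_generators_PIdl by blast
  then have "regular_local_ring \<mm> R"
    using krull noetherian_local_ring_axioms
    by (simp add: regular_local_ring_def regular_local_ring_axioms_def)
  then show ?thesis using krull by blast
qed

end
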